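(* The fixed point starting with $0$ of the morphism $0\mapsto 001,\ 1\mapsto 011$ avoids the $xyx$-formula whose fragments are all twelve words $XYX$ with $X,Y\in\{A,B,C,D\}$ and $X\neq Y$.
   Context: A formula is a finite set of non-empty words over variables (fragments), written separated by dots. An occurrence of a formula $f$ in a word $w$ is a non-erasing morphism $h$ from variables to non-empty words such that $h(\phi)$ is a factor of $w$ for every fragment $\phi$; $w$ avoids $f$ if it has no occurrence. *)

theory Defs
  imports "HOL-Library.Stream"
begin

type_synonym 'v formula = "'v list set"

definition is_formula :: "'v formula \<Rightarrow> bool" where
  "is_formula f \<longleftrightarrow> finite f \<and> [] \<notin> f"

definition is_factor :: "'a list \<Rightarrow> 'a stream \<Rightarrow> bool" where
  "is_factor u w \<longleftrightarrow> (\<exists>p s. w = p @- u @- s)"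

definition non_erasing :: "('v \<Rightarrow> 'a list) \<Rightarrow> bool" where
  "non_erasing h \<longleftrightarrow> (\<forall>x. h x \<noteq> [])"

definition morph :: "('v \<Rightarrow> 'a list) \<Rightarrow> 'v list \<Rightarrow> 'a list" where
  "morph h u = concat (map h u)"

(* The image of an infinite word.  The function flat has the intended meaning only if
   every h a is non-empty. *)
definition morph_inf :: "('v \<Rightarrow> 'a list) \<Rightarrow> 'v stream \<Rightarrow> 'a stream" where
  "morph_inf h w = flat (smap h w)"

definition occurrence :: "('v \<Rightarrow> 'a list) \<Rightarrow> 'v formula \<Rightarrow> 'a stream \<Rightarrow> bool" where
  "occurrence h f w \<longleftrightarrow> non_erasing h \<and> (\<forall>\<phi>\<in>f. is_factor (morph h \<phi>) w)"

definition avoids :: "'a stream \<Rightarrow> 'v formula \<Rightarrow> bool" where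
  "avoids w f \<longleftrightarrow> (\<nexists>h. occurrence h f w)"

datatype letter = L0 | L1

fun mu :: "letter \<Rightarrow> letter list" where
  "mu L0 = [L0, L0, L1]"
| "mu L1 = [L0, L1, L1]"

datatype var = VA | VB | VC | VD

definition xyx_formula :: "var formula" where
  "xyx_formula = {[X, Y, X] | X Y. X \<noteq> Y}"

lemma UNIV_var: "UNIV = {VA, VB, VC, VD}"
  by (auto intro: var.exhaust)

lemma xyx_formula_eq:
  "xyx_formula =
    {[VA,VB,VA], [VA,VC,VA], [VA,VD,VA], [VB,VA,VB], [VB,VC,VB], [VB,VD,VB],
     [VC,VA,VC], [VC,VB,VC], [VC,VD,VC], [VD,VA,VD], [VD,VB,VD], [VD,VC,VD]}"
    (is "_ = ?R")
proof
  show "xyx_formula \<subseteq> ?R"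
  proof
    fix \<phi> assume "\<phi> \<in> xyx_formula"
    then obtain X Y where "\<phi> = [X, Y, X]" "X \<noteq> Y"
      by (auto simp: xyx_formula_def)
    then show "\<phi> \<in> ?R" by (cases X; cases Y) simp_all
  qed
  show "?R \<subseteq> xyx_formula" by (auto simp: xyx_formula_def)
qed

lemma is_formula_xyx: "is_formula xyx_formula"
  by (simp add: is_formula_def xyx_formula_eq)

lemma card_xyx_formula: "card xyx_formula = 12"
  by (simp add: xyx_formula_eq)

lemma mu_neq_Nil: "mu a \<noteq> []"
  by (cases a) simp_all

(* The fixed point of mu starting with L0 exists and is unique, so a statement about
   every such fixed point is a statement about exactly one infinite word. *)

lemma mu_conv: "mu a = [L0, a, L1]"
  by (cases a) simp_all

lemma flat_mu: "morph_inf mu w = L0 ## shd w ## L1 ## morph_inf mu (stl w)"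
  by (cases w) (simp add: morph_inf_def mu_conv)

lemma morph_inf_mu_snth:
  "morph_inf mu w !! n = (if n mod 3 = 0 then L0 else if n mod 3 = 1 then w !! (n div 3) else L1)"
proof (induction n arbitrary: w rule: less_induct)
  case (less n)
  consider "n = 0" | "n = 1" | "n = 2" | m where "n = Suc (Suc (Suc m))"
    by (metis One_nat_def Suc_1 not0_implies_Suc)
  then show ?case
  proof cases
    case 4
    then have eq: "morph_inf mu w !! n = morph_inf mu (stl w) !! m"
      by (subst flat_mu) simp
    have "n = m + 3" using 4 by simp
    then have "n mod 3 = m mod 3" "n div 3 = Suc (m div 3)" by simp_all
    then show ?thesis using eq less.IH[of m "stl w"] 4 by simp
  qed (subst flat_mu, simp add: numeral_2_eq_2)+
qed

fun mu_word :: "nat \<Rightarrow> letter" where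
  "mu_word n = (if n = 0 then L0 else if n mod 3 = 0 then L0
     else if n mod 3 = 1 then mu_word (n div 3) else L1)"

declare mu_word.simps [simp del]

lemma stream_eqI: "(\<And>n. v !! n = w !! n) \<Longrightarrow> v = w"
  by (metis ext smap_alt stream.map_id0 id_apply)

lemma mu_fixed_point_ex1: "\<exists>!w. morph_inf mu w = w \<and> shd w = L0"
proof (rule ex1I)
  let ?w = "smap mu_word nats"
  have "morph_inf mu ?w = ?w"
  proof (rule stream_eqI)
    fix n show "morph_inf mu ?w !! n = ?w !! n"
      using mu_word.simps[of n] by (auto simp: morph_inf_mu_snth)
  qed
  moreover have "shd ?w = L0" by (simp add: mu_word.simps)
  ultimately show "morph_inf mu ?w = ?w \<and> shd ?w = L0" ..
next
  fix v assume v: "morph_inf mu v = v \<and> shd v = L0"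
  have "v !! n = mu_word n" for n
  proof (induction n rule: less_induct)
    case (less n)
    show ?case
    proof (cases "n = 0")
      case True then show ?thesis using v by (simp add: mu_word.simps)
    next
      case False
      have "v !! n = (if n mod 3 = 0 then L0 else if n mod 3 = 1 then v !! (n div 3) else L1)"
        using v morph_inf_mu_snth[of v n] by simp
      then show ?thesis using less[of "n div 3"] False by (simp add: mu_word.simps[of n])
    qed
  qed
  then show "v = smap mu_word nats" by (intro stream_eqI) simp
qed

end

theory Submission
  imports Defs
begin

text \<open>
  In the fixed point every position congruent to 0 (to 2) modulo 3 carries the letter 0 (the
  letter 1). Hence all occurrences of a nonempty factor lie in one residue class modulo 3, unless
  the factor is 0, 1 or 01; call a factor synchronised in the former case. If \<open>uvu\<close> is a factor
  and \<open>u\<close> is synchronised, then 3 divides \<open>\<bar>u\<bar> + \<bar>v\<bar>\<close>. The fixed point contains no cube of 0, 1 or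
  01, so distinct unsynchronised variables have distinct images, and counting lengths modulo 3 shows
  that all four variables have synchronised images. Then all four lengths are divisible by 3,
  all images occur in the same residue class, and taking preimages under the morphism divides all
  lengths by 3: an infinite descent.
\<close>

section \<open>Occurrences by position and their residues modulo 3\<close>

definition occurs_at :: "'a stream \<Rightarrow> 'a list \<Rightarrow> nat \<Rightarrow> bool" where
  "occurs_at w u i \<longleftrightarrow> (\<forall>j < length u. w !! (i + j) = u ! j)"

definition synchronised :: "'a stream \<Rightarrow> 'a list \<Rightarrow> bool" where
  "synchronised w u \<longleftrightarrow>
     (\<forall>i j. occurs_at w u i \<longrightarrow> occurs_at w u j \<longrightarrow> i mod 3 = j mod 3)"

definition returns_over :: "'a stream \<Rightarrow> 'a list \<Rightarrow> 'a list \<Rightarrow> bool" where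
  "returns_over w u v \<longleftrightarrow> (\<exists>i. occurs_at w u i \<and> occurs_at w v (i + length u) \<and>
     occurs_at w u (i + length u + length v))"

lemma occurs_at_nth: "occurs_at w u i \<Longrightarrow> j < length u \<Longrightarrow> w !! (i + j) = u ! j"
  by (simp add: occurs_at_def)

lemma occurs_at_append:
  "occurs_at w (u @ v) i \<longleftrightarrow> occurs_at w u i \<and> occurs_at w v (i + length u)"
  unfolding occurs_at_def
proof (intro iffI conjI allI impI)
  fix j
  assume *: "\<forall>j<length (u @ v). w !! (i + j) = (u @ v) ! j"
  show "w !! (i + j) = u ! j" if "j < length u"
    using *[rule_format, of j] that by (simp add: nth_append)
  show "w !! (i + length u + j) = v ! j" if "j < length v"
    using *[rule_format, of "length u + j"] that by (simp add: add.assoc)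
next
  fix j
  assume *: "(\<forall>j<length u. w !! (i + j) = u ! j) \<and>
    (\<forall>j<length v. w !! (i + length u + j) = v ! j)" and "j < length (u @ v)"
  then show "w !! (i + j) = (u @ v) ! j"
    using conjunct2[OF *, rule_format, of "j - length u"] by (cases "j < length u") (auto simp: nth_append)
qed

lemma is_factor_imp_occurs_at:
  assumes "is_factor u w"
  obtains i where "occurs_at w u i"
proof -
  obtain p s where "w = p @- u @- s"
    using assms by (auto simp: is_factor_def)
  then have "occurs_at w u (length p)"
    by (simp add: occurs_at_def)
  then show thesis ..
qed

lemma synchronised_returns_over_dvd:
  assumes "synchronised w u" and "returns_over w u v"
  shows "3 dvd length u + length v"
proof -
  obtain i where "occurs_at w u i" "occurs_at w u (i + (length u + length v))"
    using assms(2) by (auto simp: returns_over_def add.assoc)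
  then have "i mod 3 = (i + (length u + length v)) mod 3"
    using assms(1) unfolding synchronised_def by blast
  then show ?thesis by presburger
qed

text \<open>Desubstitution: \<open>mu\<close> puts the preimage letter in the middle of each block
  of three. When \<open>s\<close> is the offset from an occurrence of \<open>u\<close> to the first
  middle position, the letters picked are preimage letters; the blocks need not be aligned with
  \<open>u\<close>.\<close>

definition every_third :: "nat \<Rightarrow> 'a list \<Rightarrow> 'a list" where
  "every_third s u = map (\<lambda>j. u ! (s + 3 * j)) [0..<length u div 3]"

lemma length_every_third [simp]: "length (every_third s u) = length u div 3"
  by (simp add: every_third_def)

context
  fixes w :: "letter stream"
  assumes fixed_point: "morph_inf mu w = w"
begin

section \<open>Residue classes in the fixed point\<close>

lemma snth_fixed_point:
  "w !! n = (if n mod 3 = 0 then L0 else if n mod 3 = 1 then w !! (n div 3) else L1)"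
  using morph_inf_mu_snth[of w n] fixed_point by simp

lemma snth_mod_0: "n mod 3 = 0 \<Longrightarrow> w !! n = L0"
  and snth_mod_1: "n mod 3 = 1 \<Longrightarrow> w !! n = w !! (n div 3)"
  and snth_mod_2: "n mod 3 = 2 \<Longrightarrow> w !! n = L1"
  by (subst snth_fixed_point, simp)+

text \<open>Overlaying the two occurrences makes a forced 0 meet a forced 1: at offset 2, 0 or 1 for
  the residue pairs 0,1 and 0,2 and 1,2. This bounds the length; in the first case the forced
  letters before the clash spell 01.\<close>

lemma occurs_at_two_residues:
  assumes "occurs_at w u i" "occurs_at w u j" and less: "i mod 3 < j mod 3"
  shows "u \<in> {[], [L0], [L1], [L0, L1]}"
proof -
  have eq: "w !! (i + k) = u ! k" "w !! (j + k) = u ! k" if "k < length u" for k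
    using assms(1,2) that by (auto simp: occurs_at_nth)
  consider (01) "i mod 3 = 0" "j mod 3 = 1" | (02) "i mod 3 = 0" "j mod 3 = 2"
    | (12) "i mod 3 = 1" "j mod 3 = 2"
    using less by linarith
  then have "length u < 3 \<and> (length u = 2 \<longrightarrow> u ! 0 = L0 \<and> u ! 1 = L1)"
  proof cases
    case 01
    then have "(i + 0) mod 3 = 0" "(j + 1) mod 3 = 2" "(i + 2) mod 3 = 2" "(j + 2) mod 3 = 0"
      by presburger+
    then have "w !! (i + 0) = L0" "w !! (j + 1) = L1" "w !! (i + 2) = L1" "w !! (j + 2) = L0"
      by (simp_all only: snth_mod_0 snth_mod_2)
    then show ?thesis using eq[of 0] eq[of 1] eq[of 2] by (cases "u = []"; cases "length u < 3") auto
  next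
    case 02
    then have "w !! (i + 0) = L0" "w !! (j + 0) = L1"
      by (auto intro!: snth_mod_0 snth_mod_2)
    then have "\<not> 0 < length u" using eq[of 0] by auto
    then show ?thesis by simp
  next
    case 12
    then have "(i + 1) mod 3 = 2" "(j + 1) mod 3 = 0"
      by presburger+
    then have "w !! (i + 1) = L1" "w !! (j + 1) = L0"
      by (simp_all only: snth_mod_0 snth_mod_2)
    then have "\<not> 1 < length u" using eq[of 1] by auto
    then show ?thesis by simp
  qed
  then consider "u = []" | a where "u = [a]" | "u = [L0, L1]"
    by (cases u; cases "tl u"; cases "tl (tl u)") auto
  then show ?thesis
    by cases (use letter.exhaust in auto)
qed

lemma not_synchronisedD:
  assumes "\<not> synchronised w u"
  shows "u \<in> {[], [L0], [L1], [L0, L1]}"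
proof -
  obtain i j where "occurs_at w u i" "occurs_at w u j" "i mod 3 \<noteq> j mod 3"
    using assms by (auto simp: synchronised_def)
  then show ?thesis
    using occurs_at_two_residues by (metis nat_neq_iff)
qed

text \<open>The length is 1 or 2, hence coprime to 3, so the three copies start in all three residue
  classes. The first letter would be both the forced 0 and the forced 1.\<close>

lemma no_unsynchronised_cube:
  assumes "u \<in> {[L0], [L1], [L0, L1]}"
  shows "\<not> returns_over w u u"
proof
  assume "returns_over w u u"
  then obtain i where "occurs_at w u i" "occurs_at w u (i + length u)"
      "occurs_at w u (i + length u + length u)"
    by (auto simp: returns_over_def)
  from this[THEN occurs_at_nth, of 0] assms
  have eq: "w !! i = u ! 0" "w !! (i + length u) = u ! 0" "w !! (i + 2 * length u) = u ! 0"
    by (auto simp: mult_2 add.assoc)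
  have residues: "i mod 3 = r \<or> (i + length u) mod 3 = r \<or> (i + 2 * length u) mod 3 = r"
    if "r = 0 \<or> r = 2" for r
  proof -
    have "length u = 1 \<or> length u = 2" using assms by auto
    then show ?thesis
    proof
      assume len: "length u = 1"
      show ?thesis using that unfolding len by presburger
    next
      assume len: "length u = 2"
      show ?thesis using that unfolding len by presburger
    qed
  qed
  have "u ! 0 = L0"
    using residues[of 0] snth_mod_0[of i] snth_mod_0[of "i + length u"]
      snth_mod_0[of "i + 2 * length u"] unfolding eq by argo
  moreover have "u ! 0 = L1"
    using residues[of 2] snth_mod_2[of i] snth_mod_2[of "i + length u"]
      snth_mod_2[of "i + 2 * length u"] unfolding eq by argo
  ultimately show False by simp
qed

section \<open>Preimages under the morphism\<close>

lemma occurs_at_every_third: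
  assumes "occurs_at w u i" "s < 3" "(i + s) mod 3 = 1"
  shows "occurs_at w (every_third s u) ((i + s) div 3)"
  unfolding occurs_at_def
proof (intro allI impI)
  fix j assume "j < length (every_third s u)"
  then have j: "j < length u div 3" by simp
  \<comment> \<open>The bound on \<open>s\<close> keeps even the last picked index inside
    \<open>u\<close>.\<close>
  then have less: "s + 3 * j < length u" using \<open>s < 3\<close> by linarith
  have "w !! ((i + s) div 3 + j) = w !! (i + (s + 3 * j))"
    using snth_mod_1[of "i + s + 3 * j"] assms(3) by (simp add: add.assoc[symmetric] add.commute[of j])
  also have "\<dots> = u ! (s + 3 * j)"
    using assms(1) less by (rule occurs_at_nth)
  finally show "w !! ((i + s) div 3 + j) = every_third s u ! j"
    using j by (simp add: every_third_def)
qed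

text \<open>As both lengths are multiples of 3, all three blocks start in the same residue class, so
  one offset \<open>s\<close> serves them all and the distances between them are divided by exactly
  3.\<close>

lemma returns_over_every_third:
  assumes "returns_over w u v" and "3 dvd length u" "3 dvd length v"
    and "\<And>i. occurs_at w u i \<Longrightarrow> (i + s) mod 3 = 1" and "s < 3"
  shows "returns_over w (every_third s u) (every_third s v)"
proof -
  obtain i where i: "occurs_at w u i" "occurs_at w v (i + length u)"
      "occurs_at w u (i + length u + length v)"
    using assms(1) by (auto simp: returns_over_def)
  have mod: "(i + s) mod 3 = 1" using assms(4) i(1) by blast
  obtain a b where ab: "length u = 3 * a" "length v = 3 * b"
    using assms(2,3) by (auto elim!: dvdE)
  have shift: "i + 3 * a + s = (i + s) + 3 * a" "i + 3 * a + 3 * b + s = (i + s) + 3 * (a + b)"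
    by simp_all
  have "(i + 3 * a + s) mod 3 = 1" "(i + 3 * a + 3 * b + s) mod 3 = 1"
    and "(i + 3 * a + s) div 3 = (i + s) div 3 + a"
    and "(i + 3 * a + 3 * b + s) div 3 = (i + s) div 3 + a + b"
    unfolding shift mod_mult_self2 div_mult_self2 using mod by simp_all
  then show ?thesis
    unfolding returns_over_def
    using occurs_at_every_third[OF i(1) \<open>s < 3\<close>] occurs_at_every_third[OF i(2) \<open>s < 3\<close>]
      occurs_at_every_third[OF i(3) \<open>s < 3\<close>] mod ab
    by auto
qed

section \<open>Excluding short images, and the descent\<close>

lemma all_synchronised:
  fixes h :: "var \<Rightarrow> letter list"
  assumes ret: "\<And>X Y. X \<noteq> Y \<Longrightarrow> returns_over w (h X) (h Y)" and ne: "\<And>X. h X \<noteq> []"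
  shows "synchronised w (h X)"
proof (rule ccontr)
  assume X: "\<not> synchronised w (h X)"
  define N where "N = {X. \<not> synchronised w (h X)}"
  let ?W = "{[L0], [L1], [L0, L1]}"
  have N: "h Y \<in> ?W" if "Y \<in> N" for Y
    using not_synchronisedD[of "h Y"] ne[of Y] that by (auto simp: N_def)
  \<comment> \<open>Two variables of \<open>N\<close> with equal images would produce a cube of one
    of the three short words.\<close>
  have inj: "inj_on h N"
    using N ret no_unsynchronised_cube by (metis inj_onI)
  have dvd: "3 dvd length (h Y) + length (h Z)" if "Y \<notin> N" "Z \<noteq> Y" for Y Z
    using synchronised_returns_over_dvd[OF _ ret] that by (auto simp: N_def)
  have "card N \<le> card ?W"
    using N inj by (intro card_inj_on_le[of h]) auto
  then have "N \<noteq> UNIV" by (auto simp: UNIV_var)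
  then obtain D where D: "D \<notin> N" by blast
  have "X \<in> N" using X by (simp add: N_def)
  have "Y \<in> N" if "Y \<noteq> D" for Y
  proof (rule ccontr)
    assume "Y \<notin> N"
    then have "3 dvd length (h D) + length (h Y)" "3 dvd length (h D) + length (h X)"
        "3 dvd length (h Y) + length (h X)"
      using dvd[OF D, of Y] dvd[OF D, of X] dvd[OF \<open>Y \<notin> N\<close>, of X] D \<open>X \<in> N\<close> \<open>Y \<notin> N\<close> that
      by (fast | force)+
    \<comment> \<open>The first two sums minus the third give twice the length of
      \<open>h D\<close>, so 3 divides that length and hence the length of \<open>h X\<close>, which
      is only 1 or 2.\<close>
    then have "3 dvd length (h X)" by presburger
    then show False using N[OF \<open>X \<in> N\<close>] by (auto dest: dvd_imp_le)
  qed
  then have "N = UNIV - {D}" using D by auto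
  then have "card (h ` N) = card ?W"
    using inj by (simp add: card_image card_Diff_singleton) (simp add: UNIV_var)
  then have "h ` N = ?W"
    using N by (intro card_subset_eq) auto
  \<comment> \<open>All three short words are now images, so lengths 1 and 2 both occur, and the
    length of \<open>h D\<close> would be congruent to both 2 and 1.\<close>
  then obtain Y Z where "Y \<in> N" "h Y = [L0]" "Z \<in> N" "h Z = [L0, L1]"
    by (metis (no_types, lifting) imageE insertCI)
  then have "3 dvd length (h D) + 1" "3 dvd length (h D) + 2"
    using dvd[OF D, of Y] dvd[OF D, of Z] D by auto
  then show False by presburger
qed

lemma no_mutual_returns:
  fixes h :: "var \<Rightarrow> letter list"
  assumes "\<And>X Y. X \<noteq> Y \<Longrightarrow> returns_over w (h X) (h Y)" and "\<And>X. h X \<noteq> []"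
  shows False
  using assms
proof (induction "length (h VA)" arbitrary: h rule: less_induct)
  case less
  note ret = less.prems(1) and ne = less.prems(2)
  have sync: "synchronised w (h X)" for X
    using ret ne by (rule all_synchronised)
  have sum: "3 dvd length (h X) + length (h Y)" if "X \<noteq> Y" for X Y
    using synchronised_returns_over_dvd sync ret that by blast
  have dvd: "3 dvd length (h X)" for X
  proof -
    \<comment> \<open>With three variables, two pair sums minus the third isolate twice a single
      length, and 2 is invertible modulo 3.\<close>
    obtain Y Z where "Y \<noteq> X" "Z \<noteq> X" "Y \<noteq> Z"
      by (cases X) (use var.distinct in metis)+
    then show ?thesis
      using sum[of X Y] sum[of X Z] sum[of Y Z] by presburger
  qed
  obtain p where p: "occurs_at w (h VA) p"
    using ret[of VA VB] by (auto simp: returns_over_def)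
  have residue: "i mod 3 = p mod 3" if "occurs_at w (h X) i" for X i
  proof (cases "X = VA")
    case True
    then show ?thesis using sync[of VA] p that unfolding synchronised_def by blast
  next
    case False
    \<comment> \<open>Here a copy of \<open>h X\<close> starts \<open>length (h VA)\<close> after a
      copy of \<open>h VA\<close>, a shift that preserves residues.\<close>
    then obtain k where "occurs_at w (h VA) k" "occurs_at w (h X) (k + length (h VA))"
      using ret[of VA X] by (auto simp: returns_over_def)
    then have "k mod 3 = p mod 3" "(k + length (h VA)) mod 3 = i mod 3"
      using sync[of VA] sync[of X] p that unfolding synchronised_def by blast+
    moreover have "(k + length (h VA)) mod 3 = k mod 3"
      using dvd[of VA] by (auto elim!: dvdE)
    ultimately show ?thesis by simp
  qed
  obtain s where s: "s < 3" "(p + s) mod 3 = 1"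
  proof (rule that)
    \<comment> \<open>This is 1 - p modulo 3, the offset to the next middle position; 4 replaces 1
      to avoid truncated subtraction.\<close>
    show "(4 - p mod 3) mod 3 < 3" by simp
    have "p mod 3 = 0 \<or> p mod 3 = 1 \<or> p mod 3 = 2" by presburger
    then show "(p + (4 - p mod 3) mod 3) mod 3 = 1"
      by (elim disjE) (simp_all add: mod_Suc)
  qed
  have "(i + s) mod 3 = 1" if "occurs_at w (h X) i" for X i
    using residue[OF that] s(2) by (metis mod_add_left_eq)
  then have "returns_over w (every_third s (h X)) (every_third s (h Y))" if "X \<noteq> Y" for X Y
    using ret[OF that] dvd[of X] dvd[of Y] s(1) by (intro returns_over_every_third)
  moreover have "every_third s (h X) \<noteq> []" for X
  proof -
    have "3 \<le> length (h X)"
      using dvd[of X] ne[of X] by (simp add: dvd_imp_le)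
    then have "length (every_third s (h X)) \<noteq> 0"
      by (simp add: div_eq_0_iff)
    then show ?thesis by (simp only: length_0_conv not_False_eq_True)
  qed
  moreover have "length (every_third s (h VA)) < length (h VA)"
    using ne[of VA] by simp
  ultimately show False
    using less.hyps[of "\<lambda>X. every_third s (h X)"] by blast
qed

end

theorem theorem16:
  fixes w :: "letter stream"
  assumes "morph_inf mu w = w" and "shd w = L0"
  shows "avoids w xyx_formula"
  unfolding avoids_def
proof
  assume "\<exists>h. occurrence h xyx_formula w"
  then obtain h where h: "non_erasing h"
    and factor: "\<And>\<phi>. \<phi> \<in> xyx_formula \<Longrightarrow> is_factor (morph h \<phi>) w"
    by (auto simp: occurrence_def)
  have "returns_over w (h X) (h Y)" if "X \<noteq> Y" for X Y
  proof -
    have "is_factor (h X @ h Y @ h X) w"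
      using factor[of "[X, Y, X]"] that by (auto simp: xyx_formula_def morph_def)
    then show ?thesis
      by (auto simp: returns_over_def occurs_at_append elim!: is_factor_imp_occurs_at)
  qed
  then show False
    using no_mutual_returns[OF assms(1)] h by (auto simp: non_erasing_def)
qed

end
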